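(* Let $a,b,c,d$ be functions analytic at the origin $0\in\mathbb R$, with $a$ not identically zero, and consider the third order ordinary differential equation $$a(x)y'''+b(x)y''+c(x)y'+d(x)y=0 .$$ Assume that $x=0$ is an ordinary point or a regular singular point of this equation. Then a formal solution $\hat y(x)=\sum_{n=0}^\infty a_nx^n$ is always convergent in some neighborhood $|x|<R$ of the origin. Indeed, this solution converges in the same maximal interval $]-R,R[\subset\mathbb R$ where the coefficients $a(x),b(x),c(x),d(x)$ are analytic.
   Context: A formal solution is a formal power series $\hat y(x)=\sum_{n\ge0}a_nx^n$, $a_n\in\mathbb C$, satisfying the equation as an identity of formal power series. The origin is an ordinary point if $a(0)\ne0$ and a singular point if $a(0)=0$. It is a regular singular point if, for $x$ close enough to $0$, the equation can be written in the form $x^3y'''+b_1(x)x^2y''+b_2(x)xy'+b_3(x)y=0$ with $b_1,b_2,b_3$ analytic at $0$.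
   Formalization: The last claim fails for (1-x)y'''-3y''=0; it is proved with analytic on ]-R,R[ meaning the power series at 0 converges there to the function, and assuming also that a has no zero in 0<|z|<R (complex z), or instead that b_1,b_2,b_3 of the regular singular form are analytic on ]-R,R[. *)

theory Defs
  imports "HOL-Analysis.Analysis" "HOL-Computational_Algebra.Formal_Power_Series"
begin

text \<open>
  Coefficients are complex-valued functions of a real variable; real coefficients are the
  special case of values in the reals. A radius is an extended real, so that the interval
  may be the whole line.

  ``Analytic on the interval from -R to R'' means here: given on that interval by its power
  series centred at 0. For R real this is more than analyticity at each real point: the
  function 1/(1+x^2) is analytic at every real point, but counts only for R at most 1 (and
  solutions of y' = y/(1+x^2) have Taylor series with radius of convergence 1).
\<close>

definition expands_on :: "ereal \<Rightarrow> (real \<Rightarrow> complex) \<Rightarrow> complex fps \<Rightarrow> bool" where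
  "expands_on R f F \<longleftrightarrow>
     (\<forall>x. ereal \<bar>x\<bar> < R \<longrightarrow> (\<lambda>n. fps_nth F n * of_real x ^ n) sums f x)"

definition analytic_on_interval :: "ereal \<Rightarrow> (real \<Rightarrow> complex) \<Rightarrow> bool" where
  "analytic_on_interval R f \<longleftrightarrow> (\<exists>F. expands_on R f F)"

definition analytic_at_0 :: "(real \<Rightarrow> complex) \<Rightarrow> bool" where
  "analytic_at_0 f \<longleftrightarrow> (\<exists>R>0. analytic_on_interval R f)"

definition taylor_series_0 :: "(real \<Rightarrow> complex) \<Rightarrow> complex fps \<Rightarrow> bool" where
  "taylor_series_0 f F \<longleftrightarrow> (\<exists>R>0. expands_on R f F)"

definition converges_on :: "ereal \<Rightarrow> complex fps \<Rightarrow> bool" where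
  "converges_on R Y \<longleftrightarrow>
     (\<forall>x::real. ereal \<bar>x\<bar> < R \<longrightarrow> summable (\<lambda>n. fps_nth Y n * of_real x ^ n))"

definition formal_solution ::
  "(real \<Rightarrow> complex) \<Rightarrow> (real \<Rightarrow> complex) \<Rightarrow> (real \<Rightarrow> complex) \<Rightarrow> (real \<Rightarrow> complex) \<Rightarrow> complex fps \<Rightarrow> bool"
  where
  "formal_solution a b c d Y \<longleftrightarrow>
     (\<exists>A B C D. taylor_series_0 a A \<and> taylor_series_0 b B \<and>
                taylor_series_0 c C \<and> taylor_series_0 d D \<and>
        A * fps_deriv (fps_deriv (fps_deriv Y)) + B * fps_deriv (fps_deriv Y)
          + C * fps_deriv Y + D * Y = 0)"

definition ordinary_point :: "(real \<Rightarrow> complex) \<Rightarrow> bool" where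
  "ordinary_point a \<longleftrightarrow> a 0 \<noteq> 0"

text \<open>
  Near 0, multiplying the equation with coefficients \<open>a, b, c, d\<close> by \<open>x^3 / a x\<close> turns it
  into \<open>x^3 y''' + b1 x^2 y'' + b2 x y' + b3 y = 0\<close>. The point 0 itself is excluded because
  of the division; there the values of \<open>b1, b2, b3\<close> are determined once they are analytic.
\<close>

definition fuchsian_form ::
  "(real \<Rightarrow> complex) \<Rightarrow> (real \<Rightarrow> complex) \<Rightarrow> (real \<Rightarrow> complex) \<Rightarrow> (real \<Rightarrow> complex) \<Rightarrow>
   (real \<Rightarrow> complex) \<Rightarrow> (real \<Rightarrow> complex) \<Rightarrow> (real \<Rightarrow> complex) \<Rightarrow> bool"
  where
  "fuchsian_form a b c d b1 b2 b3 \<longleftrightarrow>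
     (\<forall>\<^sub>F x in at 0. a x \<noteq> 0 \<and>
        (of_real x ^ 3 / a x) * b x = b1 x * of_real x ^ 2 \<and>
        (of_real x ^ 3 / a x) * c x = b2 x * of_real x \<and>
        (of_real x ^ 3 / a x) * d x = b3 x)"

definition regular_singular_point ::
  "(real \<Rightarrow> complex) \<Rightarrow> (real \<Rightarrow> complex) \<Rightarrow> (real \<Rightarrow> complex) \<Rightarrow> (real \<Rightarrow> complex) \<Rightarrow> bool"
  where
  "regular_singular_point a b c d \<longleftrightarrow> a 0 = 0 \<and>
     (\<exists>b1 b2 b3. analytic_at_0 b1 \<and> analytic_at_0 b2 \<and> analytic_at_0 b3 \<and>
        fuchsian_form a b c d b1 b2 b3)"

text \<open>
  Analyticity of \<open>a, b, c, d\<close> alone does not bound the singularities of solutions: those of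
  \<open>(1 - x) y''' - 3 y'' = 0\<close> with \<open>y''(0) = 1\<close> have \<open>y'' = (1 - x)^(-3)\<close>, singular at 1 although
  the coefficients are polynomials. The radii up to which the equation is analytic are
  therefore those for which, in addition, the leading coefficient (extended to the complex
  disc by its power series) vanishes at most at 0.
\<close>

definition equation_analytic_on ::
  "ereal \<Rightarrow> (real \<Rightarrow> complex) \<Rightarrow> (real \<Rightarrow> complex) \<Rightarrow> (real \<Rightarrow> complex) \<Rightarrow> (real \<Rightarrow> complex) \<Rightarrow> bool"
  where
  "equation_analytic_on R a b c d \<longleftrightarrow>
     analytic_on_interval R b \<and> analytic_on_interval R c \<and> analytic_on_interval R d \<and>
     (\<exists>A. expands_on R a A \<and>
        (\<forall>z::complex. z \<noteq> 0 \<and> ereal (norm z) < R \<longrightarrow> eval_fps A z \<noteq> 0))"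

end

theory Submission
  imports Defs "HOL-Complex_Analysis.Cauchy_Integral_Formula"
begin

text \<open>
  Dividing by the leading coefficient, the equation becomes
  \<open>x^3 y''' + b1 x^2 y'' + b2 x y' + b3 y = 0\<close>, also at an ordinary point.
  The coefficients of \<open>y\<close> satisfy a recursion whose left-hand side \<open>P n * y_n\<close> has an indicial
  polynomial \<open>P\<close> of degree 3, while the factors multiplying \<open>y_i\<close> for \<open>i < n\<close> are quadratic in \<open>i\<close>,
  with geometric weights governed by the radii of convergence of \<open>b1, b2, b3\<close>. The gained factor
  \<open>1/n\<close> keeps \<open>y_n s^n\<close> bounded for every \<open>s\<close> below these radii.
\<close>

lemma bounded_of_geometric_recursion:
  fixes u :: "nat \<Rightarrow> real"
  assumes nonneg: "\<And>n. 0 \<le> u n" and q: "0 < q" "q < 1" and K: "0 \<le> K"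
    and rec: "\<And>n. N \<le> n \<Longrightarrow> real n * u n \<le> K * (\<Sum>i<n. q ^ (n - i) * u i)"
  shows "\<exists>C. \<forall>n. u n \<le> C"
proof -
  obtain N' :: nat where N': "N \<le> N'" "K / (1 - q) \<le> real N'" "0 < N'"
  proof -
    obtain m :: nat where "K / (1 - q) \<le> real m" using real_arch_simple by blast
    then show thesis by (intro that[of "max (Suc N) m"]) auto
  qed
  define C where "C = (\<Sum>i<N'. u i)"
  have C0: "0 \<le> C" unfolding C_def by (simp add: nonneg sum_nonneg)
  have "u n \<le> C" for n
  proof (induction n rule: less_induct)
    case (less n)
    show ?case
    proof (cases "n < N'")
      case True
      then show ?thesis unfolding C_def
        by (intro member_le_sum) (auto simp: nonneg)
    next
      case False
      have "(\<Sum>i<n. q ^ (n - i)) = (\<Sum>i<n. q ^ Suc i)"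
        by (rule sum.reindex_bij_witness[of _ "\<lambda>i. n - Suc i" "\<lambda>i. n - Suc i"])
           (auto simp: Suc_diff_Suc)
      also have "\<dots> \<le> (\<Sum>i<n. q ^ i)"
        using q by (intro sum_mono) (simp add: mult_left_le_one_le)
      also have "\<dots> \<le> 1 / (1 - q)"
        using q by (simp add: sum_gp_strict divide_right_mono)
      finally have geo: "(\<Sum>i<n. q ^ (n - i)) \<le> 1 / (1 - q)" .
      have "real n * u n \<le> K * (\<Sum>i<n. q ^ (n - i) * u i)"
        using rec False N' by simp
      also have "\<dots> \<le> K * (\<Sum>i<n. q ^ (n - i) * C)"
        using q K less by (intro mult_left_mono sum_mono) auto
      also have "\<dots> = K * C * (\<Sum>i<n. q ^ (n - i))"
        by (simp add: sum_distrib_right[symmetric])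
      also have "\<dots> \<le> K * C * (1 / (1 - q))"
        using geo K C0 by (intro mult_left_mono) auto
      also have "\<dots> = K / (1 - q) * C" by simp
      also have "\<dots> \<le> real n * C"
        using N' False C0 by (intro mult_right_mono) auto
      finally show ?thesis using False N' by simp
    qed
  qed
  then show ?thesis by blast
qed

lemma fps_nth_bounded_below_conv_radius:
  fixes F :: "complex fps"
  assumes "0 < r" "ereal r < fps_conv_radius F"
  obtains M where "0 \<le> M" "\<And>n. norm (fps_nth F n) \<le> M / r ^ n"
proof -
  have "summable (\<lambda>n. fps_nth F n * of_real r ^ n)"
    using assms by (intro summable_fps) simp
  then obtain M where M: "\<And>n. norm (fps_nth F n * of_real r ^ n) \<le> M"
    using summable_imp_bounded[of "\<lambda>n. fps_nth F n * of_real r ^ n"]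
    by (auto simp: bounded_iff)
  have "norm (fps_nth F n) \<le> M / r ^ n" for n
    using M[of n] assms(1) by (simp add: norm_mult norm_power field_simps)
  moreover have "0 \<le> M" using M[of 0] by (rule order_trans[OF norm_ge_zero])
  ultimately show thesis using that by blast
qed

lemma fps_conv_radius_geI_bounded:
  fixes F :: "complex fps"
  assumes "\<And>s. 0 < s \<Longrightarrow> ereal s < R \<Longrightarrow> \<exists>C. \<forall>n. norm (fps_nth F n) * s ^ n \<le> C"
  shows "R \<le> fps_conv_radius F"
  unfolding fps_conv_radius_def
proof (rule conv_radius_geI_ex')
  fix r assume r: "0 < r" "ereal r < R"
  obtain s where s: "r < s" "ereal s < R" using ereal_dense2[OF r(2)] by auto
  obtain C where C: "\<And>n. norm (fps_nth F n) * s ^ n \<le> C" using assms[of s] r s by fastforce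
  have le: "norm (fps_nth F n * of_real r ^ n) \<le> C * (r / s) ^ n" for n
  proof -
    have "norm (fps_nth F n * of_real r ^ n) = norm (fps_nth F n) * s ^ n * (r / s) ^ n"
      using r s by (simp add: norm_mult norm_power power_divide)
    also have "\<dots> \<le> C * (r / s) ^ n"
      using C r s by (intro mult_right_mono) auto
    finally show ?thesis .
  qed
  have "summable (\<lambda>n. C * (r / s) ^ n)"
    using r s by (intro summable_mult summable_geometric) auto
  then show "summable (\<lambda>n. fps_nth F n * of_real r ^ n)"
    using le by (rule summable_comparison_test')
qed

lemma fps_nth_X_power_deriv:
  fixes Y :: "complex fps"
  shows "fps_nth (fps_X * fps_deriv Y) n = of_nat n * fps_nth Y n"
    and "fps_nth (fps_X ^ 2 * fps_deriv (fps_deriv Y)) n = of_nat n * (of_nat n - 1) * fps_nth Y n"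
    and "fps_nth (fps_X ^ 3 * fps_deriv (fps_deriv (fps_deriv Y))) n
           = of_nat n * (of_nat n - 1) * (of_nat n - 2) * fps_nth Y n"
proof -
  show "fps_nth (fps_X * fps_deriv Y) n = of_nat n * fps_nth Y n"
    by (cases n) (auto simp: fps_X_mult_nth)
  consider "n = 0" | "n = 1" | "n = 2" | m where "n = Suc (Suc (Suc m))"
    by (metis One_nat_def Suc_1 not0_implies_Suc)
  then show "fps_nth (fps_X ^ 2 * fps_deriv (fps_deriv Y)) n
               = of_nat n * (of_nat n - 1) * fps_nth Y n"
    and "fps_nth (fps_X ^ 3 * fps_deriv (fps_deriv (fps_deriv Y))) n
           = of_nat n * (of_nat n - 1) * (of_nat n - 2) * fps_nth Y n"
    by (cases; simp add: fps_X_power_mult_nth eval_nat_numeral algebra_simps)+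
qed

proposition fps_conv_radius_fuchsian_solution:
  fixes Y B1 B2 B3 :: "complex fps"
  assumes eq: "fps_X ^ 3 * fps_deriv (fps_deriv (fps_deriv Y))
      + B1 * (fps_X ^ 2 * fps_deriv (fps_deriv Y)) + B2 * (fps_X * fps_deriv Y) + B3 * Y = 0"
    and R: "R \<le> fps_conv_radius B1" "R \<le> fps_conv_radius B2" "R \<le> fps_conv_radius B3"
  shows "R \<le> fps_conv_radius Y"
proof (rule fps_conv_radius_geI_bounded)
  fix s :: real assume s: "0 < s" "ereal s < R"
  obtain r where r: "s < r" "ereal r < R" using ereal_dense2[OF s(2)] by auto
  have r0: "0 < r" using r s by simp
  obtain M1 where M1: "0 \<le> M1" "\<And>n. norm (fps_nth B1 n) \<le> M1 / r ^ n"
    using fps_nth_bounded_below_conv_radius[of r B1] r r0 R by (metis less_le_trans)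
  obtain M2 where M2: "0 \<le> M2" "\<And>n. norm (fps_nth B2 n) \<le> M2 / r ^ n"
    using fps_nth_bounded_below_conv_radius[of r B2] r r0 R by (metis less_le_trans)
  obtain M3 where M3: "0 \<le> M3" "\<And>n. norm (fps_nth B3 n) \<le> M3 / r ^ n"
    using fps_nth_bounded_below_conv_radius[of r B3] r r0 R by (metis less_le_trans)
  define M where "M = M1 + M2 + M3"
  have M: "0 \<le> M" using M1 M2 M3 by (simp add: M_def)
  define c where "c k i = fps_nth B1 k * (of_nat i * (of_nat i - 1)) + fps_nth B2 k * of_nat i
                            + fps_nth B3 k" for k i
  define P where "P n = of_nat n * (of_nat n - 1) * (of_nat n - 2) + c 0 n" for n
  have rec: "P n * fps_nth Y n = - (\<Sum>i<n. c (n - i) i * fps_nth Y i)" for n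
  proof -
    have "0 = fps_nth (fps_X ^ 3 * fps_deriv (fps_deriv (fps_deriv Y))
        + (fps_X ^ 2 * fps_deriv (fps_deriv Y)) * B1 + (fps_X * fps_deriv Y) * B2 + Y * B3) n"
      using eq by (simp add: mult.commute)
    also have "\<dots> = of_nat n * (of_nat n - 1) * (of_nat n - 2) * fps_nth Y n
        + (\<Sum>i\<le>n. c (n - i) i * fps_nth Y i)"
      unfolding fps_add_nth fps_mult_nth[of _ B1] fps_mult_nth[of _ B2] fps_mult_nth[of _ B3]
        fps_nth_X_power_deriv atLeast0AtMost c_def distrib_right sum.distrib
      by (simp only: ac_simps)
    also have "\<dots> = P n * fps_nth Y n + (\<Sum>i<n. c (n - i) i * fps_nth Y i)"
      by (simp add: P_def lessThan_Suc_atMost[symmetric] algebra_simps)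
    finally show ?thesis by (simp add: eq_neg_iff_add_eq_0)
  qed
  have c_bound: "norm (c k i) \<le> M / r ^ k * real n ^ 2" if "i \<le> n" "0 < n" for k i n
  proof -
    have i1: "norm (of_nat i * (of_nat i - 1) :: complex) \<le> real n ^ 2"
    proof (cases i)
      case (Suc j)
      have "real (Suc j) * real j \<le> real n * real n"
        using that Suc by (intro mult_mono) auto
      moreover have "norm (of_nat i * (of_nat i - 1) :: complex) = real (Suc j) * real j"
        unfolding Suc norm_mult norm_of_nat by simp
      ultimately show ?thesis by (simp add: power2_eq_square)
    qed simp
    have i2: "norm (of_nat i :: complex) \<le> real n ^ 2"
    proof -
      have "real i \<le> real n * 1" using that by simp
      also have "\<dots> \<le> real n * real n" using that by (intro mult_left_mono) auto
      finally show ?thesis by (simp add: power2_eq_square)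
    qed
    have i3: "1 \<le> real n ^ 2" using that by simp
    have "norm (c k i) \<le> norm (fps_nth B1 k) * norm (of_nat i * (of_nat i - 1) :: complex)
        + norm (fps_nth B2 k) * norm (of_nat i :: complex) + norm (fps_nth B3 k) * 1"
      unfolding c_def norm_mult[symmetric] mult_1_right
      by (intro norm_triangle_mono order_refl)
    also have "\<dots> \<le> M1 / r ^ k * real n ^ 2 + M2 / r ^ k * real n ^ 2 + M3 / r ^ k * real n ^ 2"
      using M1 M2 M3 r0 by (intro add_mono mult_mono i1 i2 i3) auto
    also have "\<dots> = M / r ^ k * real n ^ 2" by (simp add: M_def add_divide_distrib algebra_simps)
    finally show ?thesis .
  qed
  obtain N :: nat where N: "6 + 2 * M \<le> real N" using real_arch_simple by blast
  have P_bound: "real n ^ 3 / 2 \<le> norm (P n)" if "N \<le> n" for n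
  proof -
    have n: "6 + 2 * M \<le> real n" using N that by simp
    have "norm (of_nat n * (of_nat n - 1) * (of_nat n - 2) :: complex)
        = norm (of_real (real n * (real n - 1) * (real n - 2)) :: complex)"
      by simp
    also have "\<dots> = real n * (real n - 1) * (real n - 2)"
      unfolding norm_of_real using n M by (intro abs_of_nonneg mult_nonneg_nonneg) auto
    finally have lead: "norm (of_nat n * (of_nat n - 1) * (of_nat n - 2) :: complex)
        = real n * (real n - 1) * (real n - 2)" .
    have "norm (c 0 n) \<le> M * real n ^ 2" using c_bound[of n n 0] n M by auto
    moreover have "norm (of_nat n * (of_nat n - 1) * (of_nat n - 2) :: complex) - norm (c 0 n)
        \<le> norm (P n)"
      unfolding P_def by (rule norm_diff_ineq)
    moreover have "(6 + 2 * M) * real n ^ 2 \<le> real n * real n ^ 2"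
      using n by (intro mult_right_mono) auto
    ultimately show ?thesis unfolding lead
      by (simp add: power2_eq_square power3_eq_cube algebra_simps)
  qed
  show "\<exists>C. \<forall>n. norm (fps_nth Y n) * s ^ n \<le> C"
  proof (rule bounded_of_geometric_recursion)
    show "0 < s / r" "s / r < 1" "0 \<le> 2 * M" using s r M by auto
    show "0 \<le> norm (fps_nth Y n) * s ^ n" for n using s by simp
    fix n assume n: "max 1 N \<le> n"
    then have n0: "0 < real n" by simp
    have "real n ^ 2 * (real n * norm (fps_nth Y n)) = 2 * (real n ^ 3 / 2 * norm (fps_nth Y n))"
      by (simp add: power2_eq_square power3_eq_cube)
    also have "\<dots> \<le> 2 * (norm (P n) * norm (fps_nth Y n))"
      using P_bound n by (intro mult_left_mono mult_right_mono) auto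
    also have "\<dots> = 2 * norm (\<Sum>i<n. c (n - i) i * fps_nth Y i)"
      using rec[of n] by (simp flip: norm_mult)
    also have "\<dots> \<le> 2 * (\<Sum>i<n. M / r ^ (n - i) * real n ^ 2 * norm (fps_nth Y i))"
      using c_bound n by (intro mult_left_mono sum_norm_le)
        (auto simp only: norm_mult lessThan_iff intro!: mult_right_mono norm_ge_zero)
    also have "\<dots> = real n ^ 2 * (2 * M * (\<Sum>i<n. norm (fps_nth Y i) / r ^ (n - i)))"
      by (simp add: sum_distrib_left algebra_simps)
    finally have "real n * norm (fps_nth Y n)
        \<le> 2 * M * (\<Sum>i<n. norm (fps_nth Y i) / r ^ (n - i))"
      using n0 by simp
    then have "real n * norm (fps_nth Y n) * s ^ n
        \<le> 2 * M * (\<Sum>i<n. norm (fps_nth Y i) / r ^ (n - i)) * s ^ n"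
      using s by (intro mult_right_mono) auto
    also have "\<dots> = 2 * M * (\<Sum>i<n. norm (fps_nth Y i) / r ^ (n - i) * s ^ n)"
      by (simp add: sum_distrib_right mult.assoc)
    also have "(\<Sum>i<n. norm (fps_nth Y i) / r ^ (n - i) * s ^ n)
        = (\<Sum>i<n. (s / r) ^ (n - i) * (norm (fps_nth Y i) * s ^ i))"
    proof (intro sum.cong refl)
      fix i assume "i \<in> {..<n}"
      then have "s ^ n = s ^ (n - i) * s ^ i" by (simp flip: power_add)
      then show "norm (fps_nth Y i) / r ^ (n - i) * s ^ n
          = (s / r) ^ (n - i) * (norm (fps_nth Y i) * s ^ i)"
        by (simp add: power_divide)
    qed
    finally show "real n * (norm (fps_nth Y n) * s ^ n)
        \<le> 2 * M * (\<Sum>i<n. (s / r) ^ (n - i) * (norm (fps_nth Y i) * s ^ i))"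
      by (simp add: mult.assoc)
  qed
qed

lemma expands_on_imp_conv_radius:
  assumes "expands_on R f F"
  shows "R \<le> fps_conv_radius F"
  unfolding fps_conv_radius_def
  using assms by (intro conv_radius_geI_ex') (auto simp: expands_on_def sums_iff)

lemma expands_on_imp_eval_fps:
  assumes "expands_on R f F" "ereal \<bar>x\<bar> < R"
  shows "f x = eval_fps F (of_real x)"
  using assms by (simp add: expands_on_def eval_fps_def sums_iff)

lemma expands_on_eval_fps:
  assumes "R \<le> fps_conv_radius F" "\<And>x. ereal \<bar>x\<bar> < R \<Longrightarrow> f x = eval_fps F (of_real x)"
  shows "expands_on R f F"
  unfolding expands_on_def
proof (intro allI impI)
  fix x :: real assume "ereal \<bar>x\<bar> < R"
  then show "(\<lambda>n. fps_nth F n * of_real x ^ n) sums f x"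
    using assms sums_eval_fps[of "of_real x :: complex" F] by auto
qed

lemma taylor_series_0_mult:
  assumes "taylor_series_0 f F" "taylor_series_0 g G"
  shows "taylor_series_0 (\<lambda>x. f x * g x) (F * G)"
proof -
  obtain R S where R: "0 < R" "expands_on R f F" and S: "0 < S" "expands_on S g G"
    using assms by (auto simp: taylor_series_0_def)
  have rad: "R \<le> fps_conv_radius F" "S \<le> fps_conv_radius G"
    using R S expands_on_imp_conv_radius by auto
  have "expands_on (min R S) (\<lambda>x. f x * g x) (F * G)"
  proof (rule expands_on_eval_fps)
    show "min R S \<le> fps_conv_radius (F * G)"
      using min.mono[OF rad] fps_conv_radius_mult by (rule order_trans)
    fix x :: real assume x: "ereal \<bar>x\<bar> < min R S"
    then have "ereal (norm (complex_of_real x)) < fps_conv_radius F"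
      "ereal (norm (complex_of_real x)) < fps_conv_radius G"
      using rad by auto
    then show "f x * g x = eval_fps (F * G) (of_real x)"
      using x R S by (simp add: eval_fps_mult expands_on_imp_eval_fps)
  qed
  then show ?thesis using R S unfolding taylor_series_0_def
    by (intro exI[of _ "min R S"]) auto
qed

lemma taylor_series_0_diff:
  assumes "taylor_series_0 f F" "taylor_series_0 g G"
  shows "taylor_series_0 (\<lambda>x. f x - g x) (F - G)"
proof -
  obtain R S where R: "0 < R" "expands_on R f F" and S: "0 < S" "expands_on S g G"
    using assms by (auto simp: taylor_series_0_def)
  have "expands_on (min R S) (\<lambda>x. f x - g x) (F - G)"
    using R S by (auto simp: expands_on_def ring_distribs intro!: sums_diff)
  then show ?thesis using R S unfolding taylor_series_0_def
    by (intro exI[of _ "min R S"]) auto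
qed

lemma taylor_series_0_X_power: "taylor_series_0 (\<lambda>x. of_real x ^ n) (fps_X ^ n)"
  unfolding taylor_series_0_def
  by (intro exI[of _ \<infinity>] conjI expands_on_eval_fps) auto

lemma taylor_series_0_imp_conv_radius_pos:
  "taylor_series_0 f F \<Longrightarrow> 0 < fps_conv_radius F"
  unfolding taylor_series_0_def using expands_on_imp_conv_radius less_le_trans by blast

lemma eventually_nhds_0_abs_less:
  assumes "0 < R"
  shows "\<forall>\<^sub>F x in nhds (0::real). ereal \<bar>x\<bar> < R"
proof -
  obtain e where e: "0 < e" "ereal e < R"
    using ereal_dense2[of 0 R] assms by auto
  have "ereal \<bar>x\<bar> < R" if "\<bar>x\<bar> < e" for x
    using that e(2) by (metis ereal_less_eq(3) less_imp_le order_le_less_trans)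
  then show ?thesis using e unfolding eventually_nhds_metric
    by (intro exI[of _ e]) (auto simp: dist_real_def)
qed

lemma taylor_series_0_isolated_zero:
  assumes "taylor_series_0 f F" "F \<noteq> 0"
  shows "\<forall>\<^sub>F x in at 0. f x \<noteq> 0"
proof -
  obtain R where R: "0 < R" "expands_on R f F"
    using assms by (auto simp: taylor_series_0_def)
  have rad: "0 < fps_conv_radius F" using assms(1) by (rule taylor_series_0_imp_conv_radius_pos)
  define G where "G = fps_shift (subdegree F) F"
  have F: "F = G * fps_X ^ subdegree F" unfolding G_def by (rule subdegree_decompose)
  have "isCont (eval_fps G) (complex_of_real 0)"
    using rad by (intro continuous_eval_fps) (simp add: G_def zero_ereal_def)
  then have "isCont (\<lambda>x. eval_fps G (complex_of_real x)) 0"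
    by (rule isCont_o2[OF continuous_of_real[OF continuous_ident]])
  then have "((\<lambda>x. eval_fps G (complex_of_real x)) \<longlongrightarrow> eval_fps G (complex_of_real 0)) (at 0)"
    unfolding isCont_def .
  moreover have "eval_fps G (complex_of_real 0) \<noteq> 0"
    using assms(2) by (simp add: eval_fps_at_0 G_def)
  ultimately have "\<forall>\<^sub>F x in at 0. eval_fps G (complex_of_real x) \<noteq> 0"
    by (rule tendsto_imp_eventually_ne)
  moreover have "\<forall>\<^sub>F x in at (0::real). ereal \<bar>x\<bar> < R"
    using eventually_nhds_0_abs_less[OF R(1)] by (auto simp: eventually_at_filter elim: eventually_mono)
  moreover have "\<forall>\<^sub>F x in at (0::real). x \<noteq> 0" by (simp add: eventually_at_filter)
  ultimately show ?thesis
  proof eventually_elim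
    case (elim x)
    have xG: "ereal (norm (complex_of_real x)) < fps_conv_radius G"
      using elim(2) expands_on_imp_conv_radius[OF R(2)] by (simp add: G_def)
    have "f x = eval_fps (G * fps_X ^ subdegree F) (of_real x)"
      using expands_on_imp_eval_fps[OF R(2) elim(2)] F by simp
    also have "\<dots> = eval_fps G (of_real x) * of_real x ^ subdegree F"
      using xG by (simp add: eval_fps_mult)
    finally show ?case using elim by simp
  qed
qed

lemma taylor_series_0_unique:
  assumes "taylor_series_0 f F" "taylor_series_0 g G" "\<forall>\<^sub>F x in at 0. f x = g x"
  shows "F = G"
proof (rule ccontr)
  assume "F \<noteq> G"
  then have "\<forall>\<^sub>F x in at 0. f x - g x \<noteq> 0"
    by (intro taylor_series_0_isolated_zero[OF taylor_series_0_diff[OF assms(1,2)]]) simp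
  then have "\<forall>\<^sub>F x in at (0::real). False"
    using assms(3) by eventually_elim simp
  then show False by simp
qed

lemma fps_conv_radius_quotient:
  fixes A P :: "complex fps"
  assumes "A \<noteq> 0" "R \<le> fps_conv_radius A" "R \<le> fps_conv_radius (A * P)"
    and nz: "\<And>z. z \<noteq> 0 \<Longrightarrow> ereal (norm z) < R \<Longrightarrow> eval_fps A z \<noteq> 0"
  shows "R \<le> fps_conv_radius P"
proof -
  define G where "G = fps_shift (subdegree A) A"
  have A: "A = G * fps_X ^ subdegree A" unfolding G_def by (rule subdegree_decompose)
  have "min R (fps_conv_radius G) \<le> fps_conv_radius (inverse G)"
  proof (rule fps_conv_radius_inverse)
    fix z :: complex assume z: "ereal (norm z) < R"
    then have "ereal (norm z) < fps_conv_radius A" using assms(2) by (rule less_le_trans)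
    with z show "eval_fps G z \<noteq> 0"
      using assms(1) nz by (simp add: G_def eval_fps_shift)
  qed
  then have "R \<le> fps_conv_radius (inverse G)" using assms(2) by (simp add: G_def)
  then have "R \<le> min (fps_conv_radius (inverse G)) (fps_conv_radius (A * P))"
    using assms(3) by simp
  also have "\<dots> \<le> fps_conv_radius (inverse G * (A * P))" by (rule fps_conv_radius_mult)
  also have "inverse G * (A * P) = (inverse G * G) * (P * fps_X ^ subdegree A)"
    by (subst A) (simp only: ac_simps)
  also have "inverse G * G = 1"
    using assms(1) by (intro inverse_mult_eq_1) (simp add: G_def)
  finally have "R \<le> fps_conv_radius (fps_shift (subdegree A) (P * fps_X ^ subdegree A))"
    by (simp only: fps_conv_radius_shift mult_1)
  then show ?thesis by (simp only: fps_shift_times_fps_X_power')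
qed

definition fps_fuchsian_form ::
  "complex fps \<Rightarrow> complex fps \<Rightarrow> complex fps \<Rightarrow> complex fps \<Rightarrow>
   complex fps \<Rightarrow> complex fps \<Rightarrow> complex fps \<Rightarrow> bool" where
  "fps_fuchsian_form A B C D B1 B2 B3 \<longleftrightarrow>
     fps_X ^ 3 * B = A * (B1 * fps_X ^ 2) \<and> fps_X ^ 3 * C = A * (B2 * fps_X) \<and>
     fps_X ^ 3 * D = A * B3"

lemma fps_fuchsian_formI:
  assumes T: "taylor_series_0 a A" "taylor_series_0 b B" "taylor_series_0 c C" "taylor_series_0 d D"
    "taylor_series_0 b1 B1" "taylor_series_0 b2 B2" "taylor_series_0 b3 B3"
    and f: "fuchsian_form a b c d b1 b2 b3"
  shows "fps_fuchsian_form A B C D B1 B2 B3"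
proof -
  note X = taylor_series_0_X_power and m = taylor_series_0_mult
  have "fps_X ^ 3 * B = A * (B1 * fps_X ^ 2)"
    by (rule taylor_series_0_unique[OF m[OF X T(2)] m[OF T(1) m[OF T(5) X]]],
        rule eventually_mono[OF f[unfolded fuchsian_form_def]]) (auto simp: field_simps)
  moreover have "fps_X ^ 3 * C = A * (B2 * fps_X ^ 1)"
    by (rule taylor_series_0_unique[OF m[OF X T(3)] m[OF T(1) m[OF T(6) X]]],
        rule eventually_mono[OF f[unfolded fuchsian_form_def]]) (auto simp: field_simps)
  moreover have "fps_X ^ 3 * D = A * B3"
    by (rule taylor_series_0_unique[OF m[OF X T(4)] m[OF T(1) T(7)]],
        rule eventually_mono[OF f[unfolded fuchsian_form_def]]) (auto simp: field_simps)
  ultimately show ?thesis by (simp add: fps_fuchsian_form_def)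
qed

lemma fps_conv_radius_fps_fuchsian_form:
  assumes "A \<noteq> 0" and form: "fps_fuchsian_form A B C D B1 B2 B3"
    and eq: "A * fps_deriv (fps_deriv (fps_deriv Y)) + B * fps_deriv (fps_deriv Y)
          + C * fps_deriv Y + D * Y = 0"
    and "R \<le> fps_conv_radius B1" "R \<le> fps_conv_radius B2" "R \<le> fps_conv_radius B3"
  shows "R \<le> fps_conv_radius Y"
proof (rule fps_conv_radius_fuchsian_solution)
  let ?L = "fps_X ^ 3 * fps_deriv (fps_deriv (fps_deriv Y))
      + B1 * (fps_X ^ 2 * fps_deriv (fps_deriv Y)) + B2 * (fps_X * fps_deriv Y) + B3 * Y"
  have form': "A * (B1 * fps_X ^ 2) = fps_X ^ 3 * B" "A * (B2 * fps_X) = fps_X ^ 3 * C"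
    "A * B3 = fps_X ^ 3 * D"
    using form by (simp_all add: fps_fuchsian_form_def)
  have "A * ?L = fps_X ^ 3 * A * fps_deriv (fps_deriv (fps_deriv Y))
      + A * (B1 * fps_X ^ 2) * fps_deriv (fps_deriv Y) + A * (B2 * fps_X) * fps_deriv Y
      + A * B3 * Y"
    by (simp add: ring_distribs ac_simps)
  also have "\<dots> = fps_X ^ 3 * (A * fps_deriv (fps_deriv (fps_deriv Y)) + B * fps_deriv (fps_deriv Y)
          + C * fps_deriv Y + D * Y)"
    unfolding form' by (simp only: ring_distribs mult.assoc)
  finally show "?L = 0" using eq assms(1) by simp
qed fact+

lemma converges_on_conv_radius: "R \<le> fps_conv_radius Y \<Longrightarrow> converges_on R Y"
  unfolding converges_on_def by (auto intro!: summable_fps)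

theorem theorem10:
  fixes a b c d :: "real \<Rightarrow> complex" and Y :: "complex fps"
  assumes "analytic_at_0 a" and "analytic_at_0 b" and "analytic_at_0 c" and "analytic_at_0 d"
    and "\<not> (\<forall>\<^sub>F x in nhds 0. a x = 0)"
    and "ordinary_point a \<or> regular_singular_point a b c d"
    and "formal_solution a b c d Y"
  shows "(\<exists>R>0. converges_on R Y) \<and>
    (\<forall>R>0. equation_analytic_on R a b c d \<longrightarrow> converges_on R Y) \<and>
    (\<forall>R>0. \<forall>b1 b2 b3.
       analytic_on_interval R b1 \<and> analytic_on_interval R b2 \<and> analytic_on_interval R b3 \<and>
       fuchsian_form a b c d b1 b2 b3 \<longrightarrow> converges_on R Y)"
proof -
  obtain A B C D where T: "taylor_series_0 a A" "taylor_series_0 b B" "taylor_series_0 c C"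
      "taylor_series_0 d D"
    and eq: "A * fps_deriv (fps_deriv (fps_deriv Y)) + B * fps_deriv (fps_deriv Y)
          + C * fps_deriv Y + D * Y = 0"
    using assms(7) by (auto simp: formal_solution_def)
  have a0: "a 0 = fps_nth A 0"
    using T(1) expands_on_imp_eval_fps[of _ a A 0]
    by (auto simp: taylor_series_0_def eval_fps_at_0 zero_ereal_def)
  have A0: "A \<noteq> 0"
  proof
    assume "A = 0"
    then obtain R where R: "0 < R" "expands_on R a 0" using T(1) by (auto simp: taylor_series_0_def)
    have "\<forall>\<^sub>F x in nhds 0. a x = 0"
      using eventually_nhds_0_abs_less[OF R(1)]
      by eventually_elim (simp add: expands_on_imp_eval_fps[OF R(2)])
    with assms(5) show False by blast
  qed
  have third: "converges_on R Y"
    if "0 < R" "analytic_on_interval R b1" "analytic_on_interval R b2" "analytic_on_interval R b3"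
      "fuchsian_form a b c d b1 b2 b3" for R b1 b2 b3
  proof -
    obtain B1 B2 B3 where E: "expands_on R b1 B1" "expands_on R b2 B2" "expands_on R b3 B3"
      using \<open>analytic_on_interval R b1\<close> \<open>analytic_on_interval R b2\<close>
        \<open>analytic_on_interval R b3\<close>
      by (auto simp: analytic_on_interval_def)
    then have "fps_fuchsian_form A B C D B1 B2 B3"
      using that T by (intro fps_fuchsian_formI[of a _ b _ c _ d _ b1 _ b2 _ b3])
        (auto simp: taylor_series_0_def)
    then show ?thesis
      using E by (intro converges_on_conv_radius fps_conv_radius_fps_fuchsian_form[OF A0 _ eq])
        (auto intro: expands_on_imp_conv_radius)
  qed
  obtain B1 B2 B3 where form: "fps_fuchsian_form A B C D B1 B2 B3"
    and pos: "0 < fps_conv_radius B1" "0 < fps_conv_radius B2" "0 < fps_conv_radius B3"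
    using assms(6)
  proof
    assume "ordinary_point a"
    then have nz: "fps_nth A 0 \<noteq> 0" by (simp add: ordinary_point_def a0)
    then have AI: "A * inverse A = 1" by (simp add: inverse_mult_eq_1')
    have I: "0 < fps_conv_radius (inverse A)"
      using nz T(1) by (intro fps_conv_radius_inverse_pos taylor_series_0_imp_conv_radius_pos)
    have pos: "0 < fps_conv_radius (inverse A * (fps_X ^ k * F))" if "taylor_series_0 f F" for f F k
    proof -
      have "0 < fps_conv_radius F" using that by (rule taylor_series_0_imp_conv_radius_pos)
      then have "0 < min (fps_conv_radius (fps_X ^ k :: complex fps)) (fps_conv_radius F)" by simp
      also have "\<dots> \<le> fps_conv_radius (fps_X ^ k * F)" by (rule fps_conv_radius_mult)
      finally have "0 < min (fps_conv_radius (inverse A)) (fps_conv_radius (fps_X ^ k * F))"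
        using I by simp
      also have "\<dots> \<le> fps_conv_radius (inverse A * (fps_X ^ k * F))" by (rule fps_conv_radius_mult)
      finally show ?thesis .
    qed
    have cancel: "A * (inverse A * F) = F" for F
      by (metis AI mult.assoc mult_1)
    have "fps_fuchsian_form A B C D (inverse A * (fps_X ^ 1 * B)) (inverse A * (fps_X ^ 2 * C))
        (inverse A * (fps_X ^ 3 * D))"
      unfolding fps_fuchsian_form_def mult.assoc cancel
      by (simp add: power2_eq_square power3_eq_cube ac_simps)
    then show thesis using that pos T by blast
  next
    assume "regular_singular_point a b c d"
    then obtain b1 b2 b3 where an: "analytic_at_0 b1" "analytic_at_0 b2" "analytic_at_0 b3"
      and f: "fuchsian_form a b c d b1 b2 b3"
      unfolding regular_singular_point_def by blast
    obtain B1 B2 B3 where B: "taylor_series_0 b1 B1" "taylor_series_0 b2 B2" "taylor_series_0 b3 B3"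
      using an[unfolded analytic_at_0_def analytic_on_interval_def] unfolding taylor_series_0_def
      by blast
    show thesis
      using fps_fuchsian_formI[OF T B f] B by (intro that taylor_series_0_imp_conv_radius_pos)
  qed
  have first: "\<exists>R>0. converges_on R Y"
  proof (intro exI conjI)
    let ?R = "min (fps_conv_radius B1) (min (fps_conv_radius B2) (fps_conv_radius B3))"
    show "0 < ?R" using pos by simp
    show "converges_on ?R Y"
      by (intro converges_on_conv_radius fps_conv_radius_fps_fuchsian_form[OF A0 form eq])
        (auto simp: min.coboundedI1 min.coboundedI2)
  qed
  have second: "converges_on R Y" if R: "0 < R" and an: "equation_analytic_on R a b c d" for R
  proof -
    have radius: "R \<le> fps_conv_radius F" if "analytic_on_interval R f" "taylor_series_0 f F" for f F
    proof -
      obtain F' where F': "expands_on R f F'" using \<open>analytic_on_interval R f\<close>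
        by (auto simp: analytic_on_interval_def)
      then have "F' = F" using R that
        by (intro taylor_series_0_unique[of f _ f]) (auto simp: taylor_series_0_def)
      then show ?thesis using F' expands_on_imp_conv_radius by blast
    qed
    obtain A' where A': "expands_on R a A'"
        "\<And>z::complex. z \<noteq> 0 \<Longrightarrow> ereal (norm z) < R \<Longrightarrow> eval_fps A' z \<noteq> 0"
      using an by (auto simp: equation_analytic_on_def)
    have "A' = A" using R A' T
      by (intro taylor_series_0_unique[of a _ a]) (auto simp: taylor_series_0_def)
    with A' have nz: "\<And>z::complex. z \<noteq> 0 \<Longrightarrow> ereal (norm z) < R \<Longrightarrow> eval_fps A z \<noteq> 0"
      and RA: "R \<le> fps_conv_radius A" using expands_on_imp_conv_radius by auto
    have quot: "R \<le> fps_conv_radius P"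
      if "fps_X ^ 3 * F = A * (P * fps_X ^ k)" "R \<le> fps_conv_radius F" for F P k
    proof -
      have "R \<le> min (fps_conv_radius (fps_X ^ 3 :: complex fps)) (fps_conv_radius F)"
        using that by simp
      also have "\<dots> \<le> fps_conv_radius (A * (P * fps_X ^ k))"
        unfolding that(1)[symmetric] by (rule fps_conv_radius_mult)
      finally have "R \<le> fps_conv_radius (P * fps_X ^ k)"
        using nz by (rule fps_conv_radius_quotient[OF A0 RA])
      then have "R \<le> fps_conv_radius (fps_shift k (P * fps_X ^ k))"
        by (simp only: fps_conv_radius_shift)
      then show ?thesis by (simp only: fps_shift_times_fps_X_power')
    qed
    have "R \<le> fps_conv_radius B1" "R \<le> fps_conv_radius B2" "R \<le> fps_conv_radius B3"
      using form an T radius quot[of B B1 2] quot[of C B2 1] quot[of D B3 0]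
      by (auto simp: fps_fuchsian_form_def equation_analytic_on_def)
    then show ?thesis
      by (intro converges_on_conv_radius fps_conv_radius_fps_fuchsian_form[OF A0 form eq])
  qed
  show ?thesis using first second third by blast
qed

end
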